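(* Let $M=\langle W,\Sigma,V\rangle$ and $M'=\langle W',\Sigma',V'\rangle$ be image-finite in-models. Then: (1) for worlds $w\in W$, $w'\in W'$, if $M,w\equiv M',w'$ then $M,w\sim M',w'$; (2) for finite states $s\subseteq W$, $s'\subseteq W'$, if $M,s\equiv M',s'$ then $M,s\sim M',s'$.
   Context: Fix a set $\mathcal P$ of atoms. Formulas of $\mathcal L_{\Rrightarrow}$ are given by $\varphi ::= p \mid \bot \mid (\varphi\wedge\varphi)\mid(\varphi\to\varphi)\mid(\varphi\veebar\varphi)\mid(\varphi\Rrightarrow\varphi)$ with $p\in\mathcal P$, where $\veebar$ denotes inquisitive disjunction. An in-model is $M=\langle W,\Sigma,V\rangle$ where $W$ is a nonempty set, $\Sigma$ assigns to each $w\in W$ a set $\Sigma(w)$ of nonempty subsets of $W$, and $V:W\times\mathcal P\to\{0,1\}$. It is image-finite if $\bigcup\Sigma(w)$ is finite for every $w\in W$. Support at $s\subseteq W$: $M,s\models p$ iff $V(w,p)=1$ for all $w\in s$; $M,s\models\bot$ iff $s=\emptyset$; $M,s\models\varphi\wedge\psi$ iff both; $M,s\models\varphi\veebar\psi$ iff $M,s\models\varphi$ or $M,s\models\psi$; $M,s\models\varphi\to\psi$ iff for all $t\subseteq s$, $M,t\models\varphi$ implies $M,t\models\psi$; $M,s\models\varphi\Rrightarrow\psi$ iff for all $w\in s$ and $t\in\Sigma(w)$, $M,t\models\varphi$ implies $M,t\models\psi$. Truth: $M,w\models\varphi$ iff $M,\{w\}\models\varphi$. $M,w\equiv M',w'$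 means $w,w'$ make true the same formulas of $\mathcal L_{\Rrightarrow}$; $M,s\equiv M',s'$ means $s,s'$ support the same formulas. Egli-Milner lifting of $R\subseteq X\times Y$: $A\overline R B$ iff every $a\in A$ has $b\in B$ with $aRb$ and every $b\in B$ has $a\in A$ with $aRb$. A bisimulation between $M$ and $M'$ is a nonempty relation $Z\subseteq W\times W'$ such that whenever $wZw'$: $V(w,p)=V'(w',p)$ for all $p\in\mathcal P$; for every $s\in\Sigma(w)$ there is $s'\in\Sigma'(w')$ with $s\overline Zs'$; for every $s'\in\Sigma'(w')$ there is $s\in\Sigma(w)$ with $s\overline Zs'$. $M,w\sim M',w'$ iff some bisimulation $Z$ has $wZw'$; $M,s\sim M',s'$ iff some bisimulation $Z$ has $s\overline Zs'$.
   Formalization: In part (2) the states s and s' are assumed not both empty: bisimulations are nonempty by definition, so for s = s' = ∅ the claim fails (two one-world models without neighbourhoods that disagree on an atom). *)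

theory Defs
  imports Main
begin

datatype 'p form =
    Atom 'p
  | Bot
  | And "'p form" "'p form"
  | Imp "'p form" "'p form"
  | InqDisj "'p form" "'p form"
  | InqCond "'p form" "'p form"  (* the modal conditional \<Rrightarrow> *)

record ('w, 'p) in_struct =
  worlds :: "'w set"
  nbhds :: "'w \<Rightarrow> 'w set set"
  val :: "'w \<Rightarrow> 'p \<Rightarrow> bool"

definition in_model :: "('w, 'p) in_struct \<Rightarrow> bool" where
  "in_model M \<longleftrightarrow>
     worlds M \<noteq> {} \<and>
     (\<forall>w\<in>worlds M. \<forall>s\<in>nbhds M w. s \<noteq> {} \<and> s \<subseteq> worlds M)"

definition image_finite :: "('w, 'p) in_struct \<Rightarrow> bool" where
  "image_finite M \<longleftrightarrow> (\<forall>w\<in>worlds M. finite (\<Union>(nbhds M w)))"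

fun supports :: "('w, 'p) in_struct \<Rightarrow> 'w set \<Rightarrow> 'p form \<Rightarrow> bool" where
  "supports M s (Atom p) \<longleftrightarrow> (\<forall>w\<in>s. val M w p)"
| "supports M s Bot \<longleftrightarrow> s = {}"
| "supports M s (And \<phi> \<psi>) \<longleftrightarrow> supports M s \<phi> \<and> supports M s \<psi>"
| "supports M s (Imp \<phi> \<psi>) \<longleftrightarrow> (\<forall>t. t \<subseteq> s \<longrightarrow> supports M t \<phi> \<longrightarrow> supports M t \<psi>)"
| "supports M s (InqDisj \<phi> \<psi>) \<longleftrightarrow> supports M s \<phi> \<or> supports M s \<psi>"
| "supports M s (InqCond \<phi> \<psi>) \<longleftrightarrow>
     (\<forall>w\<in>s. \<forall>t\<in>nbhds M w. supports M t \<phi> \<longrightarrow> supports M t \<psi>)"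

definition true_at :: "('w, 'p) in_struct \<Rightarrow> 'w \<Rightarrow> 'p form \<Rightarrow> bool" where
  "true_at M w \<phi> \<longleftrightarrow> supports M {w} \<phi>"

definition world_equiv ::
  "('w, 'p) in_struct \<Rightarrow> 'w \<Rightarrow> ('v, 'p) in_struct \<Rightarrow> 'v \<Rightarrow> bool" where
  "world_equiv M w M' w' \<longleftrightarrow> (\<forall>\<phi>. true_at M w \<phi> \<longleftrightarrow> true_at M' w' \<phi>)"

definition state_equiv ::
  "('w, 'p) in_struct \<Rightarrow> 'w set \<Rightarrow> ('v, 'p) in_struct \<Rightarrow> 'v set \<Rightarrow> bool" where
  "state_equiv M s M' s' \<longleftrightarrow> (\<forall>\<phi>. supports M s \<phi> \<longleftrightarrow> supports M' s' \<phi>)"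

text \<open>The library's \<^const>\<open>rel_set\<close> is the Egli-Milner lifting.\<close>

definition bisimulation ::
  "('w, 'p) in_struct \<Rightarrow> ('v, 'p) in_struct \<Rightarrow> ('w \<Rightarrow> 'v \<Rightarrow> bool) \<Rightarrow> bool" where
  "bisimulation M M' Z \<longleftrightarrow>
     (\<exists>w w'. Z w w') \<and>
     (\<forall>w w'. Z w w' \<longrightarrow>
        w \<in> worlds M \<and> w' \<in> worlds M' \<and>
        (\<forall>p. val M w p \<longleftrightarrow> val M' w' p) \<and>
        (\<forall>s\<in>nbhds M w. \<exists>s'\<in>nbhds M' w'. rel_set Z s s') \<and>
        (\<forall>s'\<in>nbhds M' w'. \<exists>s\<in>nbhds M w. rel_set Z s s'))"

definition world_bisimilar ::
  "('w, 'p) in_struct \<Rightarrow> 'w \<Rightarrow> ('v, 'p) in_struct \<Rightarrow> 'v \<Rightarrow> bool" where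
  "world_bisimilar M w M' w' \<longleftrightarrow> (\<exists>Z. bisimulation M M' Z \<and> Z w w')"

definition state_bisimilar ::
  "('w, 'p) in_struct \<Rightarrow> 'w set \<Rightarrow> ('v, 'p) in_struct \<Rightarrow> 'v set \<Rightarrow> bool" where
  "state_bisimilar M s M' s' \<longleftrightarrow> (\<exists>Z. bisimulation M M' Z \<and> rel_set Z s s')"

text \<open>Bisimulations are nonempty by definition, so two empty states are bisimilar only if some
  pair of worlds is. Since empty states support all formulas, the Hennessy-Milner property for
  states needs the proviso that the two states are not both empty:\<close>

lemma supports_empty: "supports M {} \<phi>"
  by (induction \<phi>) auto

lemma empty_states_equiv: "state_equiv M {} M' {}"
  by (simp add: state_equiv_def supports_empty)

lemma empty_states_not_bisimilar:
  fixes M M' :: "(unit, 'p) in_struct"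
  assumes "M = \<lparr>worlds = UNIV, nbhds = \<lambda>_. {}, val = \<lambda>_ _. True\<rparr>"
    and "M' = \<lparr>worlds = UNIV, nbhds = \<lambda>_. {}, val = \<lambda>_ _. False\<rparr>"
  shows "in_model M \<and> image_finite M \<and> in_model M' \<and> image_finite M' \<and>
    state_equiv M {} M' {} \<and> \<not> state_bisimilar M {} M' {}"
  using empty_states_equiv[of M M']
  by (auto simp: assms in_model_def image_finite_def state_bisimilar_def bisimulation_def)

end

theory Submission
  imports Defs
begin

text \<open>Modal equivalence of worlds is itself a bisimulation. Double negation makes a formula
  truth-conditional, so finitely many formulas separating worlds combine into one formula that
  separates a finite state from a world. If a neighborhood \<open>s\<close> of \<open>w\<close> is matched by none of the
  finitely many neighborhoods \<open>t\<close> of \<open>w'\<close>, then for each \<open>t\<close> there is a formula supported by exactly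
  one of \<open>s\<close> and \<open>t\<close>. With \<open>\<phi>\<close> the conjunction of those supported by \<open>s\<close> and \<open>\<psi>\<close> the inquisitive
  disjunction of the others, \<open>InqCond \<phi> \<psi>\<close> holds at \<open>w'\<close> and fails at \<open>w\<close>.\<close>

lemma supports_antimono: "supports M s \<phi> \<Longrightarrow> t \<subseteq> s \<Longrightarrow> supports M t \<phi>"
proof (induction \<phi> arbitrary: s t)
  case (Imp \<phi> \<psi>)
  from Imp.prems show ?case by simp
qed auto

abbreviation Neg :: "'p form \<Rightarrow> 'p form" where
  "Neg \<phi> \<equiv> Imp \<phi> Bot"

text \<open>Support passes to subsets, so a nonempty substate supporting \<open>\<phi>\<close> would
  contain a world where \<open>\<phi>\<close> is true. Hence negations are
  truth-conditional.\<close>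

lemma supports_Neg: "supports M s (Neg \<phi>) \<longleftrightarrow> (\<forall>w\<in>s. \<not> true_at M w \<phi>)"
proof
  assume *: "supports M s (Neg \<phi>)"
  have "\<not> supports M {w} \<phi>" if "w \<in> s" for w
    using *[unfolded supports.simps, THEN spec, of "{w}"] that by simp
  then show "\<forall>w\<in>s. \<not> true_at M w \<phi>"
    unfolding true_at_def by blast
next
  assume *: "\<forall>w\<in>s. \<not> true_at M w \<phi>"
  have "t = {}" if "t \<subseteq> s" "supports M t \<phi>" for t
    using * that supports_antimono[of M t \<phi>] unfolding true_at_def by blast
  then show "supports M s (Neg \<phi>)"
    by simp
qed

lemma true_at_Neg: "true_at M w (Neg \<phi>) \<longleftrightarrow> \<not> true_at M w \<phi>"
  unfolding true_at_def[of M w "Neg \<phi>"] supports_Neg by simp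

lemma supports_Neg_Neg: "supports M s (Neg (Neg \<phi>)) \<longleftrightarrow> (\<forall>w\<in>s. true_at M w \<phi>)"
  unfolding supports_Neg[of M s] true_at_Neg by simp

lemma true_at_InqDisj: "true_at M w (InqDisj \<phi> \<psi>) \<longleftrightarrow> true_at M w \<phi> \<or> true_at M w \<psi>"
  by (simp add: true_at_def)

lemma world_equiv_sym: "world_equiv M w M' w' \<longleftrightarrow> world_equiv M' w' M w"
  by (auto simp: world_equiv_def)

text \<open>Equivalence may fail in either direction; negation turns a formula true only at
  \<open>w'\<close> into one true only at \<open>w\<close>.\<close>

lemma world_separation:
  assumes "\<not> world_equiv M w M' w'"
  obtains \<alpha> where "true_at M w \<alpha>" "\<not> true_at M' w' \<alpha>"
proof -
  obtain \<alpha> where "true_at M w \<alpha> \<noteq> true_at M' w' \<alpha>"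
    using assms unfolding world_equiv_def by blast
  then show thesis
    using that[of \<alpha>] that[of "Neg \<alpha>"] true_at_Neg[of M w \<alpha>] true_at_Neg[of M' w' \<alpha>] by blast
qed

lemma state_world_separation:
  assumes "finite s" and "\<forall>w\<in>s. \<not> world_equiv M w M' w'"
  obtains \<alpha> where "supports M s \<alpha>" "\<not> true_at M' w' \<alpha>"
proof -
  have "\<exists>\<alpha>. (\<forall>w\<in>s. true_at M w \<alpha>) \<and> \<not> true_at M' w' \<alpha>"
    using assms
  proof (induction s rule: finite_induct)
    case empty
    \<comment> \<open>\<open>Bot\<close> serves as the empty disjunction.\<close>
    show ?case by (rule exI[of _ Bot]) (simp add: true_at_def)
  next
    case (insert w s)
    then obtain \<alpha> where \<alpha>: "\<forall>v\<in>s. true_at M v \<alpha>" "\<not> true_at M' w' \<alpha>"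
      by auto
    obtain \<beta> where \<beta>: "true_at M w \<beta>" "\<not> true_at M' w' \<beta>"
      using insert.prems by (auto elim: world_separation)
    show ?case
      by (rule exI[of _ "InqDisj \<beta> \<alpha>"]) (use \<alpha> \<beta> in \<open>simp add: true_at_InqDisj\<close>)
  qed
  then obtain \<alpha> where "\<forall>w\<in>s. true_at M w \<alpha>" "\<not> true_at M' w' \<alpha>"
    by blast
  \<comment> \<open>Truth of \<open>\<alpha>\<close> at every world of \<open>s\<close> need not
    give support by \<open>s\<close>; its double negation is supported and has the same truth
    values.\<close>
  then show thesis
    using that[of "Neg (Neg \<alpha>)"] by (simp add: supports_Neg_Neg true_at_Neg del: supports.simps)
qed

text \<open>If the lifting fails, some world of one state has no equivalent in the other. The other
  state then supports a formula false at that world, and persistence keeps the first state from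
  supporting it.\<close>

lemma state_separation:
  assumes "finite s" "finite t" and "\<not> rel_set (\<lambda>w w'. world_equiv M w M' w') s t"
  shows "\<exists>\<alpha>. supports M s \<alpha> \<noteq> supports M' t \<alpha>"
proof -
  consider w where "w \<in> s" "\<forall>w'\<in>t. \<not> world_equiv M' w' M w"
    | w' where "w' \<in> t" "\<forall>w\<in>s. \<not> world_equiv M w M' w'"
    using assms(3) unfolding rel_set_def world_equiv_sym[of M' _ M] by blast
  then show ?thesis
  proof cases
    case 1
    obtain \<alpha> where "supports M' t \<alpha>" "\<not> true_at M w \<alpha>"
      using state_world_separation[OF assms(2) 1(2)] .
    then show ?thesis
      using 1(1) supports_antimono[of M s \<alpha> "{w}"] unfolding true_at_def by blast
  next
    case 2
    obtain \<alpha> where "supports M s \<alpha>" "\<not> true_at M' w' \<alpha>"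
      using state_world_separation[OF assms(1) 2(2)] .
    then show ?thesis
      using 2(1) supports_antimono[of M' t \<alpha> "{w'}"] unfolding true_at_def by blast
  qed
qed

text \<open>Induction on \<open>T\<close>: a formula telling \<open>s\<close> from a new
  \<open>t\<close> either strengthens \<open>\<phi>\<close> so that \<open>t\<close> fails to
  support it, or weakens \<open>\<psi>\<close> so that \<open>t\<close> supports it. Neither change
  spoils the condition for the earlier members.\<close>

lemma state_family_separation:
  assumes "finite T" "s \<noteq> {}" and "\<forall>t\<in>T. \<exists>\<alpha>. supports M s \<alpha> \<noteq> supports M' t \<alpha>"
  shows "\<exists>\<phi> \<psi>. supports M s \<phi> \<and> \<not> supports M s \<psi> \<and>
           (\<forall>t\<in>T. supports M' t \<phi> \<longrightarrow> supports M' t \<psi>)"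
  using assms(1,3)
proof (induction T rule: finite_induct)
  case empty
  \<comment> \<open>The empty conjunction and the empty disjunction; the latter is not supported
    because \<open>s\<close> is nonempty.\<close>
  have "supports M s (Neg Bot)" "\<not> supports M s Bot"
    using assms(2) by auto
  then show ?case by blast
next
  case (insert t T)
  then obtain \<phi> \<psi> where IH: "supports M s \<phi>" "\<not> supports M s \<psi>"
    "\<forall>t\<in>T. supports M' t \<phi> \<longrightarrow> supports M' t \<psi>"
    by auto
  obtain \<alpha> where \<alpha>: "supports M s \<alpha> \<noteq> supports M' t \<alpha>"
    using insert.prems by blast
  show ?case
  proof (cases "supports M s \<alpha>")
    case True
    show ?thesis
      by (rule exI[of _ "And \<alpha> \<phi>"], rule exI[of _ \<psi>]) (use IH \<alpha> True in auto)
  next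
    case False
    show ?thesis
      by (rule exI[of _ \<phi>], rule exI[of _ "InqDisj \<alpha> \<psi>"]) (use IH \<alpha> False in auto)
  qed
qed

lemma world_equiv_forth:
  assumes "in_model M" "image_finite M" "image_finite M'"
    and "w \<in> worlds M" "w' \<in> worlds M'" "world_equiv M w M' w'" "s \<in> nbhds M w"
  shows "\<exists>t\<in>nbhds M' w'. rel_set (\<lambda>w w'. world_equiv M w M' w') s t"
proof (rule ccontr)
  assume no_match: "\<not> ?thesis"
  have fin: "finite (\<Union>(nbhds M' w'))" "finite (\<Union>(nbhds M w))"
    using assms unfolding image_finite_def by auto
  \<comment> \<open>A family with finite union lies in a finite power set.\<close>
  have fin_nbhds: "finite (nbhds M' w')"
    using fin(1) by (rule finite_UnionD)
  have nonempty: "s \<noteq> {}"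
    using assms unfolding in_model_def by blast
  have "finite s" "\<forall>t\<in>nbhds M' w'. finite t"
    using fin assms(7) by (meson Union_upper finite_subset)+
  then have "\<forall>t\<in>nbhds M' w'. \<exists>\<alpha>. supports M s \<alpha> \<noteq> supports M' t \<alpha>"
    using no_match state_separation by blast
  from state_family_separation[OF fin_nbhds nonempty this]
  obtain \<phi> \<psi> where "supports M s \<phi>" "\<not> supports M s \<psi>"
    "\<forall>t\<in>nbhds M' w'. supports M' t \<phi> \<longrightarrow> supports M' t \<psi>"
    by (elim exE conjE)
  \<comment> \<open>At a singleton, \<open>InqCond\<close> ranges over the neighborhoods of its
    world; for \<open>w\<close>, the neighborhood \<open>s\<close> is the counterexample.\<close>
  then have "true_at M' w' (InqCond \<phi> \<psi>)" "\<not> true_at M w (InqCond \<phi> \<psi>)"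
    using assms(7) by (auto simp: true_at_def)
  then show False
    using assms(6) unfolding world_equiv_def by blast
qed

text \<open>Equivalence is symmetric, so this is the forth condition with the models
  exchanged.\<close>

lemma world_equiv_back:
  assumes "in_model M'" "image_finite M" "image_finite M'"
    and "w \<in> worlds M" "w' \<in> worlds M'" "world_equiv M w M' w'" "t \<in> nbhds M' w'"
  shows "\<exists>s\<in>nbhds M w. rel_set (\<lambda>w w'. world_equiv M w M' w') s t"
  using world_equiv_forth[of M' M w' w t] assms
  unfolding rel_set_def world_equiv_sym[of M' _ M] by blast

text \<open>\<open>world_equiv\<close> may also relate elements of the types outside the two models,
  whereas a bisimulation relates worlds only.\<close>

lemma rel_set_restrict:
  assumes "rel_set R s t" "s \<subseteq> A" "t \<subseteq> B"
  shows "rel_set (\<lambda>x y. x \<in> A \<and> y \<in> B \<and> R x y) s t"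
  using assms unfolding rel_set_def by blast

lemma bisimulation_world_equiv:
  assumes "in_model M" "in_model M'" "image_finite M" "image_finite M'"
    and "w \<in> worlds M" "w' \<in> worlds M'" "world_equiv M w M' w'"
  shows "bisimulation M M' (\<lambda>w w'. w \<in> worlds M \<and> w' \<in> worlds M' \<and> world_equiv M w M' w')"
    (is "bisimulation M M' ?Z")
  unfolding bisimulation_def
proof (intro conjI allI impI ballI)
  show "\<exists>w w'. ?Z w w'"
    using assms by blast
next
  fix v v' assume v: "?Z v v'"
  then show "v \<in> worlds M" "v' \<in> worlds M'"
    by auto
  show "val M v p \<longleftrightarrow> val M' v' p" for p
    using v unfolding world_equiv_def true_at_def by (auto dest!: spec[of _ "Atom p"])
  have sub: "s \<subseteq> worlds M" if "s \<in> nbhds M v" for s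
    using that v assms(1) unfolding in_model_def by blast
  have sub': "t \<subseteq> worlds M'" if "t \<in> nbhds M' v'" for t
    using that v assms(2) unfolding in_model_def by blast
  show "\<exists>t\<in>nbhds M' v'. rel_set ?Z s t" if s: "s \<in> nbhds M v" for s
  proof -
    obtain t where "t \<in> nbhds M' v'" "rel_set (\<lambda>w w'. world_equiv M w M' w') s t"
      using world_equiv_forth[OF assms(1,3,4) _ _ _ s] v by blast
    then show ?thesis
      using rel_set_restrict[OF _ sub[OF s] sub'] by (intro bexI[of _ t])
  qed
  show "\<exists>s\<in>nbhds M v. rel_set ?Z s t" if t: "t \<in> nbhds M' v'" for t
  proof -
    obtain s where "s \<in> nbhds M v" "rel_set (\<lambda>w w'. world_equiv M w M' w') s t"
      using world_equiv_back[OF assms(2,3,4) _ _ _ t] v by blast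
    then show ?thesis
      using rel_set_restrict[OF _ sub sub'[OF t]] by (intro bexI[of _ s])
  qed
qed

theorem theorem5p12:
  fixes M :: "('w, 'p) in_struct" and M' :: "('v, 'p) in_struct"
  assumes "in_model M" and "in_model M'"
    and "image_finite M" and "image_finite M'"
  shows "(\<forall>w\<in>worlds M. \<forall>w'\<in>worlds M'.
            world_equiv M w M' w' \<longrightarrow> world_bisimilar M w M' w') \<and>
         (\<forall>s s'. s \<subseteq> worlds M \<and> s' \<subseteq> worlds M' \<and> finite s \<and> finite s' \<and>
            (s \<noteq> {} \<or> s' \<noteq> {}) \<and> state_equiv M s M' s' \<longrightarrow> state_bisimilar M s M' s')"
proof (intro conjI ballI allI impI)
  fix w w' assume "w \<in> worlds M" "w' \<in> worlds M'" "world_equiv M w M' w'"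
  then show "world_bisimilar M w M' w'"
    using bisimulation_world_equiv[OF assms] unfolding world_bisimilar_def by blast
next
  fix s s'
  assume A: "s \<subseteq> worlds M \<and> s' \<subseteq> worlds M' \<and> finite s \<and> finite s' \<and>
    (s \<noteq> {} \<or> s' \<noteq> {}) \<and> state_equiv M s M' s'"
  then have rel: "rel_set (\<lambda>w w'. world_equiv M w M' w') s s'"
    using state_separation unfolding state_equiv_def by blast
  \<comment> \<open>One state is nonempty by the proviso, and the lifting then yields an equivalent
    pair, which makes the bisimulation nonempty.\<close>
  moreover obtain w w' where "w \<in> s" "w' \<in> s'" "world_equiv M w M' w'"
    using A rel unfolding rel_set_def by blast
  ultimately show "state_bisimilar M s M' s'"
    using A bisimulation_world_equiv[OF assms, of w w']
      rel_set_restrict[OF rel, of "worlds M" "worlds M'"]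
    unfolding state_bisimilar_def by blast
qed

end
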